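(* Let $p$ be a prime number, and let $a, b, m, n, s \in \{1, 2, \ldots, p-1\}$ with $a \neq b$. Put $M=m+n+s-(p-1)$ and $R=m+n+s-2(p-1)$. Then, modulo $p$, the sum $$\sum_{k=0}^{p-1} (a+k)^m (b+k)^n k^s$$ is congruent to: - $-3$, if $m=n=s=p-1$; - $-b^{n+s-(p-1)} \binom{n}{p-1-s} - (b-a)^{n}(-a)^s$, if $m=p-1$ and $(n,s) \neq (p-1,p-1)$; - $\displaystyle -\sum_{j=0}^{M-m-1} \binom{m}{R-j} \binom{n}{j}a^{R-j} b^j -\sum_{j=M-m}^{n} \binom{m}{M-j} \binom{n}{j}a^{M-j} b^j$, otherwise.
   Context: Congruences are in $\mathbb{Z}/p\mathbb{Z}$; negative powers of integers prime to $p$ are powers of the inverse modulo $p$. Binomial coefficients $\binom{u}{v}$ are $0$ unless $0 \le v \le u$ (in particular $\binom{n}{j}=0$ for $j<0$, so terms with negative index $j$ vanish). A sum whose upper limit is smaller than its lower limit is $0$. *)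

theory Defs
  imports "HOL-Number_Theory.Number_Theory"
begin

text \<open>
  Integer powers modulo \<open>p\<close>, as an integer representative: a negative exponent
  denotes a power of the inverse modulo \<open>p\<close>. Meaningful when \<open>x\<close> is coprime to \<open>p\<close>
  or the exponent is nonnegative.
\<close>
definition powi_mod :: "int \<Rightarrow> int \<Rightarrow> int \<Rightarrow> int" where
  "powi_mod p x e = (if 0 \<le> e then x ^ nat e else modular_inverse p x ^ nat (- e))"

text \<open>
  Binomial coefficients with integer arguments, zero outside \<open>0 \<le> v \<le> u\<close>. This is not
  \<^term>\<open>(gchoose)\<close>, which does not vanish at negative upper arguments.
\<close>
definition binom :: "int \<Rightarrow> int \<Rightarrow> int" where
  "binom u v = (if 0 \<le> v \<and> v \<le> u then int (nat u choose nat v) else 0)"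

end

theory Submission
  imports Defs
begin

text \<open>
  For \<open>d > 0\<close> the power sum of the \<open>k\<^sup>d\<close> over a full residue system modulo \<open>p\<close> is \<open>-1\<close> if
  \<open>p - 1\<close> divides \<open>d\<close> and \<open>0\<close> otherwise (\<open>sum_powers_cong\<close>). Hence summing a polynomial in \<open>k\<close>
  without constant term over all residues returns minus the sum of its coefficients at the
  positive multiples of \<open>p - 1\<close>. The polynomial \<open>(a + k)\<^sup>m (b + k)\<^sup>n k\<^sup>s\<close> has degree \<open>m + n + s\<close>,
  and the coefficient of \<open>k\<^sup>d\<close> collects the products of the \<open>i\<close>-th term of \<open>(a + k)\<^sup>m\<close> and the
  \<open>j\<close>-th term of \<open>(b + k)\<^sup>n\<close> with \<open>i + j = m + n + s - d\<close>
  (\<open>sum_two_shifted_powers_cong\<close>). As long as the degree stays below \<open>3 (p - 1)\<close>, only \<open>d = p - 1\<close>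
  and \<open>d = 2 (p - 1)\<close> contribute, and these are \<open>i + j = M\<close> and \<open>i + j = R\<close>. When \<open>m < p - 1\<close>, the
  terms with \<open>i + j = M\<close> have \<open>j \<ge> M - m\<close>, whereas those with \<open>i + j = R\<close> have \<open>j \<le> R < M - m\<close>, so
  that the two coefficients fill disjoint ranges of \<open>j\<close>.

  For \<open>m = p - 1\<close> it is simpler to use Fermat: \<open>(a + k)\<^sup>m\<close> is the indicator of \<open>k \<noteq> -a\<close>, so this
  factor only removes the term at \<open>k = -a\<close> (\<open>sum_fermat_factor_cong\<close>). What is left is a sum with one
  binomial factor, whose degree is below \<open>2 (p - 1)\<close> unless \<open>n = s = p - 1\<close>; in that last case Fermat
  applies again, and exactly the three classes \<open>0\<close>, \<open>-a\<close> and \<open>-b\<close> are missing from a sum of ones.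
\<close>

section \<open>Power sums modulo a prime\<close>

lemma fermat_indicator:
  fixes x :: int
  assumes "prime p"
  shows "[x ^ (p - 1) = 1 - of_bool (int p dvd x)] (mod int p)"
proof (cases "int p dvd x")
  case True
  moreover have "p - 1 > 0" using prime_gt_1_nat[OF assms] by simp
  ultimately show ?thesis by (simp add: cong_0_iff dvd_power dvd_trans)
next
  case False
  have p0: "int p > 0" using prime_gt_0_nat[OF assms] by simp
  define y where "y = nat (x mod int p)"
  have y: "int y = x mod int p" using p0 by (simp add: y_def)
  have "\<not> p dvd y"
    using False by (metis y int_dvd_int_iff dvd_mod_iff dvd_refl)
  hence "[int (y ^ (p - 1)) = int 1] (mod int p)"
    using fermat_theorem[OF assms] cong_int_iff by blast
  moreover have "[x ^ (p - 1) = int y ^ (p - 1)] (mod int p)"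
    by (intro cong_pow) (simp add: y cong_def)
  ultimately show ?thesis using False by (auto intro: cong_trans)
qed

text \<open>
  If \<open>p - 1\<close> divides \<open>d\<close>, every nonzero residue contributes \<open>1\<close>. Otherwise a primitive root \<open>g\<close>
  satisfies \<open>g\<^sup>d \<noteq> 1\<close>, and since multiplication by \<open>g\<close> permutes the nonzero residues, the sum is
  fixed by multiplication by \<open>g\<^sup>d\<close> and has to vanish. The exponent \<open>d = 0\<close> is different because
  then \<open>k = 0\<close> contributes \<open>1\<close> as well, and the sum is \<open>p\<close>.
\<close>

lemma sum_powers_cong:
  assumes p: "prime p" and "d > 0"
  shows "[(\<Sum>k = 0..p - 1. int k ^ d) = - of_bool (p - 1 dvd d)] (mod int p)"
proof -
  have p1: "p > 1" using prime_gt_1_nat[OF p] .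
  define S :: int where "S = (\<Sum>k = 1..<int p. k ^ d)"
  have "(\<Sum>k = 0..p - 1. int k ^ d) = (\<Sum>k = 1..<p. int k ^ d)"
    using p1 \<open>d > 0\<close> by (intro sum.mono_neutral_right) auto
  also have "\<dots> = S"
    unfolding S_def
    by (rule sum.reindex_bij_witness[where i = nat and j = int]) auto
  finally have S: "(\<Sum>k = 0..p - 1. int k ^ d) = S" .
  have "[S = - of_bool (p - 1 dvd d)] (mod int p)"
  proof (cases "p - 1 dvd d")
    case True
    then obtain q where q: "d = (p - 1) * q" by blast
    have "[S = (\<Sum>k = 1..<int p. 1)] (mod int p)"
      unfolding S_def
    proof (rule cong_sum)
      fix k assume "k \<in> {1..<int p}"
      hence "\<not> int p dvd k" using zdvd_not_zless by auto
      hence "[k ^ (p - 1) = 1] (mod int p)" using fermat_indicator[OF p, of k] by simp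
      from cong_pow[OF this, of q] show "[k ^ d = 1] (mod int p)"
        by (simp add: q power_mult)
    qed
    also have "(\<Sum>k = 1..<int p. 1) = int p - 1" using p1 by simp
    also have "[int p - 1 = - 1] (mod int p)" by (simp add: cong_iff_dvd_diff)
    finally show ?thesis using True by simp
  next
    case False
    obtain g where g: "residue_primroot p g" using prime_primitive_root_exists[OF p1 p] by blast
    hence cop: "coprime (int g) (int p)" and ord: "ord p g = p - 1"
      by (auto simp: residue_primroot_def coprime_commute totient_prime[OF p])
    hence "\<not> [g ^ d = 1] (mod p)" using False by (simp add: ord_divides' ord)
    hence g1: "\<not> int p dvd int g ^ d - 1"
      using cong_int_iff[of "g ^ d" 1 p] by (simp add: cong_iff_dvd_diff)
    have "S = (\<Sum>k = 1..<int p. (int g * k mod int p) ^ d)"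
      unfolding S_def
      by (rule sum.reindex_bij_betw[OF bij_betw_int_remainders_mult[OF cop], symmetric])
    also have "[\<dots> = (\<Sum>k = 1..<int p. (int g * k) ^ d)] (mod int p)"
      by (intro cong_sum cong_pow) (simp add: cong_def)
    also have "(\<Sum>k = 1..<int p. (int g * k) ^ d) = int g ^ d * S"
      by (simp add: S_def power_mult_distrib sum_distrib_left)
    finally have "int p dvd int g ^ d * S - S" by (meson cong_iff_dvd_diff cong_sym)
    hence "int p dvd (int g ^ d - 1) * S" by (simp add: algebra_simps)
    hence "int p dvd S" using g1 p by (simp add: prime_dvd_mult_iff)
    thus ?thesis using False by (simp add: cong_0_iff)
  qed
  thus ?thesis by (simp only: S)
qed

section \<open>Sums of products of shifted powers\<close>

lemma sum_shifted_power_cong: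
  assumes p: "prime p" and "s > 0"
  shows "[(\<Sum>k = 0..p - 1. (b + int k) ^ n * int k ^ s) =
    - (\<Sum>j\<le>n. of_bool (p - 1 dvd n + s - j) * (int (n choose j) * b ^ j))] (mod int p)"
proof -
  have "(\<Sum>k = 0..p - 1. (b + int k) ^ n * int k ^ s)
      = (\<Sum>k = 0..p - 1. \<Sum>j\<le>n. (int (n choose j) * b ^ j) * int k ^ (n + s - j))"
    by (intro sum.cong refl) (simp add: binomial_ring sum_distrib_right mult.assoc flip: power_add)
  also have "\<dots> = (\<Sum>j\<le>n. (int (n choose j) * b ^ j) * (\<Sum>k = 0..p - 1. int k ^ (n + s - j)))"
    by (subst sum.swap) (simp add: sum_distrib_left)
  also have "[\<dots> = (\<Sum>j\<le>n. (int (n choose j) * b ^ j) * - of_bool (p - 1 dvd n + s - j))] (mod int p)"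
    using \<open>s > 0\<close> by (intro cong_sum cong_mult cong_refl sum_powers_cong[OF p]) auto
  finally show ?thesis by (simp add: sum_negf mult.commute)
qed

lemma sum_two_shifted_powers_cong:
  assumes p: "prime p" and "s > 0"
  shows "[(\<Sum>k = 0..p - 1. (a + int k) ^ m * (b + int k) ^ n * int k ^ s) =
    - (\<Sum>i\<le>m. \<Sum>j\<le>n. of_bool (p - 1 dvd m + n + s - i - j) *
          (int (m choose i) * a ^ i * (int (n choose j) * b ^ j)))] (mod int p)"
proof -
  let ?c = "\<lambda>i. int (m choose i) * a ^ i" and ?d = "\<lambda>j. int (n choose j) * b ^ j"
  let ?T = "\<lambda>i. \<Sum>k = 0..p - 1. (b + int k) ^ n * int k ^ (m + s - i)"
  have summand: "(a + int k) ^ m * (b + int k) ^ n * int k ^ s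
      = (\<Sum>i\<le>m. ?c i * ((b + int k) ^ n * int k ^ (m + s - i)))" for k
  proof -
    have "(a + int k) ^ m * (b + int k) ^ n * int k ^ s
        = (\<Sum>i\<le>m. ?c i * int k ^ (m - i)) * ((b + int k) ^ n * int k ^ s)"
      by (simp only: binomial_ring[of a] mult.assoc of_nat_id)
    also have "\<dots> = (\<Sum>i\<le>m. ?c i * ((b + int k) ^ n * int k ^ (m + s - i)))"
      unfolding sum_distrib_right
    proof (intro sum.cong refl)
      fix i assume "i \<in> {..m}"
      hence "int k ^ (m + s - i) = int k ^ (m - i) * int k ^ s"
        by (simp flip: power_add)
      thus "?c i * int k ^ (m - i) * ((b + int k) ^ n * int k ^ s)
          = ?c i * ((b + int k) ^ n * int k ^ (m + s - i))"
        by simp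
    qed
    finally show ?thesis .
  qed
  have expand: "(\<Sum>k = 0..p - 1. (a + int k) ^ m * (b + int k) ^ n * int k ^ s) = (\<Sum>i\<le>m. ?c i * ?T i)"
    unfolding summand by (subst sum.swap) (simp only: sum_distrib_left)
  have inner: "[(\<Sum>i\<le>m. ?c i * ?T i) =
      (\<Sum>i\<le>m. ?c i * - (\<Sum>j\<le>n. of_bool (p - 1 dvd n + (m + s - i) - j) * ?d j))] (mod int p)"
    using \<open>s > 0\<close> by (intro cong_sum cong_mult cong_refl sum_shifted_power_cong[OF p]) auto
  have exponent: "n + (m + s - i) - j = m + n + s - i - j" if "i \<le> m" for i j
    using that by simp
  have "(\<Sum>i\<le>m. ?c i * - (\<Sum>j\<le>n. of_bool (p - 1 dvd n + (m + s - i) - j) * ?d j))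
      = - (\<Sum>i\<le>m. \<Sum>j\<le>n. of_bool (p - 1 dvd m + n + s - i - j) * (?c i * ?d j))"
    unfolding mult_minus_right sum_negf sum_distrib_left
    by (intro arg_cong[where f = uminus] sum.cong refl)
       (simp only: atMost_iff exponent mult.left_commute)
  from inner[unfolded this] show ?thesis unfolding expand .
qed

text \<open>
  By Fermat the factor \<open>(a + k)\<^bsup>p - 1\<^esup>\<close> is \<open>1\<close> modulo \<open>p\<close> except at \<open>k = p - a\<close>, where it
  vanishes.
\<close>

lemma sum_fermat_factor_cong:
  fixes f :: "int \<Rightarrow> int"
  assumes p: "prime p" and a: "a \<in> {1..p - 1}"
  shows "[(\<Sum>k = 0..p - 1. (int a + int k) ^ (p - 1) * f (int k)) =
    (\<Sum>k = 0..p - 1. f (int k)) - f (int p - int a)] (mod int p)"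
proof -
  have *: "int p dvd int a + int k \<longleftrightarrow> k = p - a" if "k \<in> {0..p - 1}" for k
  proof
    assume "int p dvd int a + int k"
    hence "p dvd a + k" by (metis int_dvd_int_iff of_nat_add)
    then obtain q where q: "a + k = p * q" by blast
    have "0 < a + k" "a + k < p * 2" using a that by auto
    hence "0 < q" "q < 2" by (simp_all add: q)
    hence "q = 1" by linarith
    thus "k = p - a" using q by simp
  qed (use a in auto)
  have "[(\<Sum>k = 0..p - 1. (int a + int k) ^ (p - 1) * f (int k)) =
      (\<Sum>k = 0..p - 1. (1 - of_bool (int p dvd int a + int k)) * f (int k))] (mod int p)"
    by (intro cong_sum cong_mult cong_refl fermat_indicator[OF p])
  also have "(\<Sum>k = 0..p - 1. (1 - of_bool (int p dvd int a + int k)) * f (int k))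
      = (\<Sum>k = 0..p - 1. f (int k) - (if k = p - a then f (int k) else 0))"
    by (intro sum.cong refl) (simp add: *)
  also have "\<dots> = (\<Sum>k = 0..p - 1. f (int k)) - f (int (p - a))"
  proof -
    have "p - a \<in> {0..p - 1}" using a by auto
    thus ?thesis by (simp only: sum_subtractf sum.delta' finite_atLeastAtMost if_True sum.delta)
  qed
  also have "int (p - a) = int p - int a" using a by auto
  finally show ?thesis .
qed

section \<open>Binomial terms with integer indices\<close>

text \<open>
  The term of degree \<open>v\<close> of the expansion of \<open>(1 + x)\<^sup>u\<close>, for any integer \<open>v\<close>. It is zero outside
  the range of the expansion, where the exponent could be negative, so a sum over its index may run
  over any set of integers that contains this range.
\<close>

definition binom_term :: "int \<Rightarrow> int \<Rightarrow> int \<Rightarrow> int \<Rightarrow> int" where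
  "binom_term p x u v = binom u v * powi_mod p x v"

lemma binom_nat: "binom (int u) (int v) = int (u choose v)"
  by (simp add: binom_def binomial_eq_0)

lemma binom_term_nat: "binom_term p x (int u) (int v) = int (u choose v) * x ^ v"
  by (simp add: binom_term_def binom_nat powi_mod_def)

lemma binom_term_outside: "v < 0 \<or> u < v \<Longrightarrow> binom_term p x u v = 0"
  by (auto simp: binom_term_def binom_def)

lemma sum_binom_term_singleton:
  "(\<Sum>i\<le>u. of_bool (int i = e) * (int (u choose i) * x ^ i)) = binom_term p x (int u) e"
proof (cases "0 \<le> e \<and> e \<le> int u")
  case True
  then obtain v where v: "e = int v" "v \<le> u" by (metis nonneg_int_cases of_nat_le_iff)
  have "(\<Sum>i\<le>u. of_bool (int i = e) * (int (u choose i) * x ^ i))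
      = (\<Sum>i\<le>u. if i = v then int (u choose i) * x ^ i else 0)"
    by (intro sum.cong) (auto simp: v)
  thus ?thesis using v by (simp add: binom_term_nat)
next
  case False
  thus ?thesis by (subst sum.neutral) (auto simp: binom_term_outside)
qed

lemma sum_binom_term_reindex:
  assumes "finite A" and "\<And>j. 0 \<le> j \<Longrightarrow> j \<le> int n \<Longrightarrow> j \<notin> A \<Longrightarrow> f j = 0"
  shows "(\<Sum>j\<le>n. f (int j) * binom_term p b (int n) (int j))
    = (\<Sum>j\<in>A. f j * binom_term p b (int n) j)"
proof -
  have "(\<Sum>j\<le>n. f (int j) * binom_term p b (int n) (int j))
      = (\<Sum>j = 0..int n. f j * binom_term p b (int n) j)"
    by (rule sum.reindex_bij_witness[where i = nat and j = int]) auto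
  also have "\<dots> = (\<Sum>j\<in>A. f j * binom_term p b (int n) j)"
    using assms by (intro sum.mono_neutral_cong) (auto simp: binom_term_outside)
  finally show ?thesis .
qed

text \<open>
  The exponents \<open>d\<close> of \<open>k\<close> in the expansion satisfy \<open>0 < d < 3 (p - 1)\<close>, so the only multiples of \<open>p - 1\<close> among them
  are \<open>p - 1\<close> and \<open>2 (p - 1)\<close>.
\<close>

lemma sum_two_shifted_powers_binom_term_cong:
  assumes p: "prime p" and "s > 0" and deg: "m + n + s < 3 * (p - 1)"
    and M: "M = int m + int n + int s - (int p - 1)"
    and R: "R = int m + int n + int s - 2 * (int p - 1)"
  shows "[(\<Sum>k = 0..p - 1. (a + int k) ^ m * (b + int k) ^ n * int k ^ s) =
    - (\<Sum>j\<le>n. binom_term (int p) a (int m) (R - int j) * binom_term (int p) b (int n) (int j))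
    - (\<Sum>j\<le>n. binom_term (int p) a (int m) (M - int j) * binom_term (int p) b (int n) (int j))]
    (mod int p)"
proof -
  let ?c = "\<lambda>i. int (m choose i) * a ^ i" and ?d = "\<lambda>j. int (n choose j) * b ^ j"
  have p1: "p > 1" using prime_gt_1_nat[OF p] .
  have split: "of_bool (p - 1 dvd m + n + s - i - j)
      = (of_bool (int i = R - int j) + of_bool (int i = M - int j) :: int)"
    if "i \<le> m" "j \<le> n" for i j
  proof -
    let ?e = "m + n + s - i - j"
    have e: "int ?e = int m + int n + int s - int i - int j" using that by simp
    have "p - 1 dvd ?e \<longleftrightarrow> ?e = p - 1 \<or> ?e = 2 * (p - 1)"
    proof
      assume "p - 1 dvd ?e"
      then obtain q where q: "?e = (p - 1) * q" by blast
      have "(p - 1) * 0 < (p - 1) * q" "(p - 1) * q < (p - 1) * 3"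
        using q that deg \<open>s > 0\<close> by linarith+
      hence "0 < q" "q < 3" by (simp_all only: mult_less_cancel1)
      hence "q = 1 \<or> q = 2" by linarith
      thus "?e = p - 1 \<or> ?e = 2 * (p - 1)" using q by auto
    qed (auto simp del: diff_diff_left)
    moreover have "?e = p - 1 \<longleftrightarrow> int i = M - int j"
      using e M p1 by linarith
    moreover have "?e = 2 * (p - 1) \<longleftrightarrow> int i = R - int j"
    proof -
      have "?e = 2 * (p - 1) \<longleftrightarrow> int ?e = int (2 * (p - 1))" by (simp only: of_nat_eq_iff)
      also have "int (2 * (p - 1)) = 2 * (int p - 1)" using p1 by simp
      finally show ?thesis unfolding e R by auto
    qed
    ultimately show ?thesis using M R p1 by auto
  qed
  have collect: "(\<Sum>i\<le>m. \<Sum>j\<le>n. of_bool (int i = E - int j) * (?c i * ?d j))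
      = (\<Sum>j\<le>n. binom_term (int p) a (int m) (E - int j) * binom_term (int p) b (int n) (int j))"
    for E
  proof -
    have "(\<Sum>i\<le>m. \<Sum>j\<le>n. of_bool (int i = E - int j) * (?c i * ?d j))
        = (\<Sum>j\<le>n. (\<Sum>i\<le>m. of_bool (int i = E - int j) * ?c i) * ?d j)"
      by (subst sum.swap) (simp add: sum_distrib_right mult.assoc)
    thus ?thesis by (simp only: sum_binom_term_singleton[where p = "int p"] binom_term_nat)
  qed
  have "(\<Sum>i\<le>m. \<Sum>j\<le>n. of_bool (p - 1 dvd m + n + s - i - j) * (?c i * ?d j))
      = (\<Sum>i\<le>m. \<Sum>j\<le>n. of_bool (int i = R - int j) * (?c i * ?d j)
          + of_bool (int i = M - int j) * (?c i * ?d j))"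
    by (intro sum.cong refl) (simp only: split atMost_iff distrib_right)
  also have "\<dots> = (\<Sum>i\<le>m. \<Sum>j\<le>n. of_bool (int i = R - int j) * (?c i * ?d j))
      + (\<Sum>i\<le>m. \<Sum>j\<le>n. of_bool (int i = M - int j) * (?c i * ?d j))"
    by (simp only: sum.distrib)
  finally show ?thesis
    using sum_two_shifted_powers_cong[OF p \<open>s > 0\<close>, of a m b n] by (simp only: collect minus_add_distrib add_uminus_conv_diff)
qed

section \<open>Exponents below the Fermat bound\<close>

text \<open>
  In degree below \<open>2 (p - 1)\<close> only the exponent \<open>p - 1\<close> of \<open>k\<close> contributes, which leaves the single
  term \<open>j = n + s - (p - 1)\<close> of the binomial expansion.
\<close>

lemma sum_shifted_power_single_term_cong:
  assumes p: "prime p" and "s > 0" and s: "s \<le> p - 1" and deg: "n + s < 2 * (p - 1)"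
  shows "[(\<Sum>k = 0..p - 1. (b + int k) ^ n * int k ^ s) =
    - (powi_mod (int p) b (int n + int s - (int p - 1)) * binom (int n) (int p - 1 - int s))]
    (mod int p)"
proof -
  have p1: "p > 1" using prime_gt_1_nat[OF p] .
  let ?e = "int n + int s - (int p - 1)"
  have dvd: "p - 1 dvd n + s - j \<longleftrightarrow> int j = ?e" if "j \<le> n" for j
  proof
    assume "p - 1 dvd n + s - j"
    then obtain q where q: "n + s - j = (p - 1) * q" by blast
    have "(p - 1) * 0 < (p - 1) * q" "(p - 1) * q < (p - 1) * 2"
      using q that deg \<open>s > 0\<close> by linarith+
    hence "0 < q" "q < 2" by (simp_all only: mult_less_cancel1)
    hence "q = 1" by linarith
    hence "n + s - j = p - 1" using q by simp
    thus "int j = ?e" using that p1 by linarith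
  next
    assume "int j = ?e"
    hence "n + s - j = p - 1" using that p1 by linarith
    thus "p - 1 dvd n + s - j" by simp
  qed
  have "(\<Sum>j\<le>n. of_bool (p - 1 dvd n + s - j) * (int (n choose j) * b ^ j))
      = (\<Sum>j\<le>n. of_bool (int j = ?e) * (int (n choose j) * b ^ j))"
    by (intro sum.cong refl) (simp only: dvd atMost_iff)
  also have "\<dots> = binom_term (int p) b (int n) ?e"
    by (rule sum_binom_term_singleton)
  also have "\<dots> = powi_mod (int p) b ?e * binom (int n) (int p - 1 - int s)"
  proof -
    have "binom (int n) ?e = binom (int n) (int p - 1 - int s)"
    proof (cases "0 \<le> ?e")
      case True
      \<comment> \<open>The indices \<open>n + s - (p - 1)\<close> and \<open>p - 1 - s\<close> add up to \<open>n\<close>; when the first is negative,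
        the second exceeds \<open>n\<close>.\<close>
      define c where "c = p - 1 - s"
      have c: "int p - 1 - int s = int c" "?e = int (n - c)" "c \<le> n"
        using True s p1 by (auto simp: c_def)
      show ?thesis unfolding c(1,2) binom_nat by (simp only: binomial_symmetric[OF c(3)])
    qed (auto simp: binom_def)
    thus ?thesis by (simp only: binom_term_def mult.commute)
  qed
  finally show ?thesis using sum_shifted_power_cong[OF p \<open>s > 0\<close>, of b n] by (simp only:)
qed

text \<open>
  The terms with \<open>i + j = R\<close> have \<open>j \<le> R = M - (p - 1) \<le> M - m - 1\<close>, and those with \<open>i + j = M\<close> have
  \<open>j \<ge> M - m\<close>: the ranges of the two sums contain every nonzero term.
\<close>

lemma sum_two_shifted_powers_split_cong:
  assumes p: "prime p" and m: "m < p - 1" and n: "n \<le> p - 1" and "s > 0" and s: "s \<le> p - 1"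
    and M: "M = int m + int n + int s - (int p - 1)"
    and R: "R = int m + int n + int s - 2 * (int p - 1)"
  shows "[(\<Sum>k = 0..p - 1. (a + int k) ^ m * (b + int k) ^ n * int k ^ s) =
        - (\<Sum>j = 0..M - int m - 1. binom (int m) (R - j) * binom (int n) j
             * powi_mod (int p) a (R - j) * powi_mod (int p) b j)
        - (\<Sum>j = M - int m..int n. binom (int m) (M - j) * binom (int n) j
             * powi_mod (int p) a (M - j) * powi_mod (int p) b j)] (mod (int p))"
proof -
  have products: "binom (int m) (E - j) * binom (int n) j * powi_mod (int p) a (E - j) * powi_mod (int p) b j
      = binom_term (int p) a (int m) (E - j) * binom_term (int p) b (int n) j" for E j
    by (simp add: binom_term_def mult_ac)
  have "m + n + s < 3 * (p - 1)" using m n s by linarith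
  note sum_two_shifted_powers_binom_term_cong[OF p \<open>s > 0\<close> this M R, of a b]
  moreover have "(\<Sum>j\<le>n. binom_term (int p) a (int m) (R - int j) * binom_term (int p) b (int n) (int j))
      = (\<Sum>j = 0..M - int m - 1. binom_term (int p) a (int m) (R - j) * binom_term (int p) b (int n) j)"
    using m M R
    by (intro sum_binom_term_reindex[where f = "\<lambda>j. binom_term (int p) a (int m) (R - j)"])
       (auto intro!: binom_term_outside)
  moreover have "(\<Sum>j\<le>n. binom_term (int p) a (int m) (M - int j) * binom_term (int p) b (int n) (int j))
      = (\<Sum>j = M - int m..int n. binom_term (int p) a (int m) (M - j) * binom_term (int p) b (int n) j)"
    by (intro sum_binom_term_reindex[where f = "\<lambda>j. binom_term (int p) a (int m) (M - j)"])
       (auto intro!: binom_term_outside)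
  ultimately show ?thesis by (simp only: products)
qed

section \<open>Three shifted powers over a full residue system\<close>

theorem theorem3p6:
  fixes p a b m n s :: nat and M R :: int
  assumes "prime p"
    and "a \<in> {1..p - 1}" and "b \<in> {1..p - 1}"
    and "m \<in> {1..p - 1}" and "n \<in> {1..p - 1}" and "s \<in> {1..p - 1}"
    and "a \<noteq> b"
    and "M = int m + int n + int s - (int p - 1)"
    and "R = int m + int n + int s - 2 * (int p - 1)"
  shows "[(\<Sum>k = 0..p - 1. (int a + int k) ^ m * (int b + int k) ^ n * int k ^ s) =
     (if m = p - 1 \<and> n = p - 1 \<and> s = p - 1 then - 3
      else if m = p - 1 \<and> (n, s) \<noteq> (p - 1, p - 1) then
        - (powi_mod (int p) (int b) (int n + int s - (int p - 1)) * binom (int n) (int p - 1 - int s))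
        - (int b - int a) ^ n * (- int a) ^ s
      else
        - (\<Sum>j = 0..M - int m - 1. binom (int m) (R - j) * binom (int n) j
             * powi_mod (int p) (int a) (R - j) * powi_mod (int p) (int b) j)
        - (\<Sum>j = M - int m..int n. binom (int m) (M - j) * binom (int n) j
             * powi_mod (int p) (int a) (M - j) * powi_mod (int p) (int b) j))] (mod (int p))"
proof (cases "m = p - 1")
  case True
  let ?f = "\<lambda>k. (int b + k) ^ n * k ^ s"
  \<comment> \<open>The residue \<open>-a\<close> is represented by \<open>p - a\<close> in the range of summation.\<close>
  have shift: "[?f (int p - int a) = (int b - int a) ^ n * (- int a) ^ s] (mod int p)"
    by (intro cong_mult cong_pow) (simp_all add: cong_iff_dvd_diff)
  have "[(\<Sum>k = 0..p - 1. (int a + int k) ^ m * ?f (int k)) =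
      (\<Sum>k = 0..p - 1. ?f (int k)) - ?f (int p - int a)] (mod int p)"
    unfolding True by (rule sum_fermat_factor_cong) (use assms in auto)
  also have "[(\<Sum>k = 0..p - 1. ?f (int k)) - ?f (int p - int a) =
      (\<Sum>k = 0..p - 1. ?f (int k)) - (int b - int a) ^ n * (- int a) ^ s] (mod int p)"
    by (intro cong_diff cong_refl shift)
  finally have red: "[(\<Sum>k = 0..p - 1. (int a + int k) ^ m * (int b + int k) ^ n * int k ^ s) =
      (\<Sum>k = 0..p - 1. ?f (int k)) - (int b - int a) ^ n * (- int a) ^ s] (mod int p)"
    by (simp only: mult.assoc)
  show ?thesis
  proof (cases "n = p - 1 \<and> s = p - 1")
    case ns: True
    \<comment> \<open>Since \<open>a \<noteq> b\<close>, the numbers \<open>-a\<close>, \<open>p - b\<close> and \<open>b - a\<close> are all units modulo \<open>p\<close>, so every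
      removed term is \<open>1\<close>.\<close>
    have unit: "[x ^ (p - 1) = 1] (mod int p)" if "x \<noteq> 0" "\<bar>x\<bar> < int p" for x
    proof -
      have "\<not> int p dvd x" using that dvd_imp_le_int[of x "int p"] by auto
      thus ?thesis using fermat_indicator[OF assms(1), of x] by simp
    qed
    have "[(\<Sum>k = 0..p - 1. (int b + int k) ^ (p - 1) * int k ^ (p - 1)) =
        (\<Sum>k = 0..p - 1. int k ^ (p - 1)) - (int p - int b) ^ (p - 1)] (mod int p)"
      by (rule sum_fermat_factor_cong[where f = "\<lambda>k. k ^ (p - 1)"]) (use assms in auto)
    also have "[(\<Sum>k = 0..p - 1. int k ^ (p - 1)) - (int p - int b) ^ (p - 1) = - 1 - 1] (mod int p)"
      using sum_powers_cong[OF assms(1), of "p - 1"] assms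
      by (intro cong_diff unit) auto
    finally have two: "[(\<Sum>k = 0..p - 1. ?f (int k)) = - 1 - 1] (mod int p)"
      using ns by simp
    have "[(int b - int a) ^ (p - 1) * (- int a) ^ (p - 1) = 1 * 1] (mod int p)"
    proof (intro cong_mult unit)
      have "1 \<le> a" "a < p" "1 \<le> b" "b < p" using assms(2,3) by auto
      thus "int b - int a \<noteq> 0" "\<bar>int b - int a\<bar> < int p" "- int a \<noteq> 0" "\<bar>- int a\<bar> < int p"
        using assms(7) by linarith+
    qed
    hence "[(int b - int a) ^ n * (- int a) ^ s = 1 * 1] (mod int p)"
      by (simp only: ns)
    from cong_trans[OF red cong_diff[OF two this]] show ?thesis using True ns by simp
  next
    case ns: False
    hence "n + s < 2 * (p - 1)" using assms(5,6) by auto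
    hence "[(\<Sum>k = 0..p - 1. ?f (int k)) =
        - (powi_mod (int p) (int b) (int n + int s - (int p - 1)) * binom (int n) (int p - 1 - int s))]
        (mod int p)"
      using assms by (intro sum_shifted_power_single_term_cong) auto
    note generic = cong_trans[OF red cong_diff[OF this cong_refl]]
    have "\<not> (m = p - 1 \<and> n = p - 1 \<and> s = p - 1)" and "m = p - 1 \<and> (n, s) \<noteq> (p - 1, p - 1)"
      using True ns by auto
    thus ?thesis using generic by presburger
  qed
next
  case False
  have "[(\<Sum>k = 0..p - 1. (int a + int k) ^ m * (int b + int k) ^ n * int k ^ s) =
        - (\<Sum>j = 0..M - int m - 1. binom (int m) (R - j) * binom (int n) j
             * powi_mod (int p) (int a) (R - j) * powi_mod (int p) (int b) j)
        - (\<Sum>j = M - int m..int n. binom (int m) (M - j) * binom (int n) j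
             * powi_mod (int p) (int a) (M - j) * powi_mod (int p) (int b) j)] (mod (int p))"
    using False assms by (intro sum_two_shifted_powers_split_cong) auto
  thus ?thesis using False by simp
qed

end
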